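(* Let $(B,\cdot,[\cdot,\cdot,\cdot])$ be a (finite-dimensional) transposed Poisson 3-Lie algebra over a field $\mathbb F$ of characteristic zero. Suppose there is a nondegenerate symmetric bilinear form $\mathcal B:B\times B\to\mathbb F$ that is invariant on both $(B,\cdot)$ and $(B,[\cdot,\cdot,\cdot])$, i.e. $\mathcal B(x\cdot y,z)=\mathcal B(x,y\cdot z)$ and $\mathcal B([x,y,z],w)=-\mathcal B([x,y,w],z)$ for all $x,y,z,w\in B$. Then $$w\cdot[x,y,z]=[w\cdot x,y,z]=0\qquad\text{for all }x,y,z,w\in B.$$
   Context: A 3-Lie algebra is a vector space with a skew-symmetric trilinear bracket satisfying $[x_1,x_2,[x_3,x_4,x_5]]=[[x_1,x_2,x_3],x_4,x_5]+[x_3,[x_1,x_2,x_4],x_5]+[x_3,x_4,[x_1,x_2,x_5]]$. A transposed Poisson 3-Lie algebra is a triple $(B,\cdot,[\cdot,\cdot,\cdot])$ where $(B,\cdot)$ is a commutative associative algebra (no unit assumed), $(B,[\cdot,\cdot,\cdot])$ is a 3-Lie algebra, and $3w\cdot[x,y,z]=[w\cdot x,y,z]+[x,w\cdot y,z]+[x,y,w\cdot z]$ for all $x,y,z,w\in B$. *)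

theory Defs
  imports Complex_Main
begin

definition bilinear_map ::
    "('f::field \<Rightarrow> 'a::ab_group_add \<Rightarrow> 'a) \<Rightarrow> ('f \<Rightarrow> 'b::ab_group_add \<Rightarrow> 'b)
     \<Rightarrow> ('a \<Rightarrow> 'a \<Rightarrow> 'b) \<Rightarrow> bool" where
  "bilinear_map s1 s2 f \<longleftrightarrow>
     (\<forall>y. Vector_Spaces.linear s1 s2 (\<lambda>x. f x y)) \<and>
     (\<forall>x. Vector_Spaces.linear s1 s2 (\<lambda>y. f x y))"

definition trilinear_map ::
    "('f::field \<Rightarrow> 'a::ab_group_add \<Rightarrow> 'a) \<Rightarrow> ('f \<Rightarrow> 'b::ab_group_add \<Rightarrow> 'b)
     \<Rightarrow> ('a \<Rightarrow> 'a \<Rightarrow> 'a \<Rightarrow> 'b) \<Rightarrow> bool" where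
  "trilinear_map s1 s2 f \<longleftrightarrow>
     (\<forall>y z. Vector_Spaces.linear s1 s2 (\<lambda>x. f x y z)) \<and>
     (\<forall>x z. Vector_Spaces.linear s1 s2 (\<lambda>y. f x y z)) \<and>
     (\<forall>x y. Vector_Spaces.linear s1 s2 (\<lambda>z. f x y z))"

(* The product is an explicit parameter rather than a type class operation, so that
   no unit is assumed and the scalars may be any field. *)
locale comm_assoc_algebra = vector_space scale
  for scale :: "'f::field \<Rightarrow> 'b::ab_group_add \<Rightarrow> 'b" +
  fixes mult :: "'b \<Rightarrow> 'b \<Rightarrow> 'b"
  assumes mult_bilinear: "bilinear_map scale scale mult"
    and mult_assoc: "mult (mult x y) z = mult x (mult y z)"
    and mult_commute: "mult x y = mult y x"

(* The two adjacent transpositions generate all permutations of the three arguments. *)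
locale three_lie_algebra = vector_space scale
  for scale :: "'f::field \<Rightarrow> 'b::ab_group_add \<Rightarrow> 'b" +
  fixes bracket :: "'b \<Rightarrow> 'b \<Rightarrow> 'b \<Rightarrow> 'b"
  assumes bracket_trilinear: "trilinear_map scale scale bracket"
    and bracket_skew12: "bracket x y z = - bracket y x z"
    and bracket_skew23: "bracket x y z = - bracket x z y"
    and fundamental_identity:
      "bracket x1 x2 (bracket x3 x4 x5) =
         bracket (bracket x1 x2 x3) x4 x5
         + bracket x3 (bracket x1 x2 x4) x5
         + bracket x3 x4 (bracket x1 x2 x5)"

locale transposed_poisson_three_lie_algebra =
  comm_assoc_algebra scale mult + three_lie_algebra scale bracket
  for scale :: "'f::field \<Rightarrow> 'b::ab_group_add \<Rightarrow> 'b"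
    and mult :: "'b \<Rightarrow> 'b \<Rightarrow> 'b"
    and bracket :: "'b \<Rightarrow> 'b \<Rightarrow> 'b \<Rightarrow> 'b" +
  assumes transposed_leibniz:
    "scale 3 (mult w (bracket x y z)) =
       bracket (mult w x) y z + bracket x (mult w y) z + bracket x y (mult w z)"

definition symmetric_form :: "('b \<Rightarrow> 'b \<Rightarrow> 'f) \<Rightarrow> bool" where
  "symmetric_form B \<longleftrightarrow> (\<forall>x y. B x y = B y x)"

(* The left radical is zero; for symmetric forms this is also the right radical. *)
definition nondegenerate_form :: "('b::zero \<Rightarrow> 'b \<Rightarrow> 'f::zero) \<Rightarrow> bool" where
  "nondegenerate_form B \<longleftrightarrow> (\<forall>x. (\<forall>y. B x y = 0) \<longrightarrow> x = 0)"

definition mult_invariant_form :: "('b \<Rightarrow> 'b \<Rightarrow> 'b) \<Rightarrow> ('b \<Rightarrow> 'b \<Rightarrow> 'f) \<Rightarrow> bool" where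
  "mult_invariant_form mult B \<longleftrightarrow> (\<forall>x y z. B (mult x y) z = B x (mult y z))"

definition bracket_invariant_form ::
    "('b \<Rightarrow> 'b \<Rightarrow> 'b \<Rightarrow> 'b) \<Rightarrow> ('b \<Rightarrow> 'b \<Rightarrow> 'f::uminus) \<Rightarrow> bool" where
  "bracket_invariant_form bracket B \<longleftrightarrow>
     (\<forall>x y z w. B (bracket x y z) w = - B (bracket x y w) z)"

end

theory Submission
  imports Defs
begin

text \<open>
  Invariance makes \<open>F x y z u = B [x, y, z] u\<close> an alternating 4-form. Pairing the transposed
  Leibniz rule with \<open>u\<close> says that three times the value of \<open>F\<close> with \<open>w\<close> acting on the last slot is
  the sum of its values with \<open>w\<close> acting on each of the other slots; by skew symmetry the same holds
  for every slot, so all four values agree. Hence \<open>w [x, y, z] = [w x, y, z]\<close>, an expression that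
  is symmetric in \<open>w, x\<close> and skew in \<open>x, y, z\<close>, and therefore zero.
\<close>

lemma (in vector_space) eq_neg_self_imp_zero:
  fixes v :: 'b
  assumes "(2::'a) \<noteq> 0" and "v = - v"
  shows "v = 0"
proof -
  have "scale 2 v = v + v"
    using scale_left_distrib[of 1 1 v] by simp
  also have "\<dots> = 0"
    using assms(2) by (metis add.right_inverse)
  finally show ?thesis
    using assms(1) by simp
qed

context transposed_poisson_three_lie_algebra
begin

text \<open>By nondegeneracy it suffices to pair both sides with every \<open>u\<close>; this
  compares \<open>w\<close> acting on the fourth and on the third slot of the 4-form. Their
  difference comes out multiplied by 4.\<close>

lemma mult_bracket_right_of_invariant_form:
  fixes B :: "'b \<Rightarrow> 'b \<Rightarrow> 'f"
  assumes four: "(4::'f) \<noteq> 0"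
    and bil: "bilinear_map scale (*) B"
    and nondeg: "nondegenerate_form B"
    and mult_inv: "mult_invariant_form mult B"
    and bracket_inv: "bracket_invariant_form bracket B"
  shows "mult w (bracket x y z) = bracket x y (mult w z)"
proof -
  have lin: "Vector_Spaces.linear scale (*) (\<lambda>a. B a u)" for u
    using bil unfolding bilinear_map_def by blast
  have B_diff: "B (a - b) u = B a u - B b u" for a b u
    using lin Vector_Spaces.linear.axioms(3) module_hom.diff by fastforce
  have B_add: "B (a + b) u = B a u + B b u" for a b u
    using lin Vector_Spaces.linear.axioms(3) module_hom.add by fastforce
  have B_scale: "B (scale c a) u = c * B a u" for c a u
    using lin Vector_Spaces.linear.axioms(3) module_hom.scale by fastforce
  have skew: "B (bracket a b c) d = - B (bracket a b d) c" for a b c d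
    using bracket_inv unfolding bracket_invariant_form_def by blast
  have shift: "B (mult w a) u = B a (mult w u)" for a u
    using mult_inv mult_commute unfolding mult_invariant_form_def by metis
  have slot: "3 * B (bracket x y c) (mult w d) =
      B (bracket (mult w x) y c) d + B (bracket x (mult w y) c) d + B (bracket x y (mult w c)) d"
    for c d
    using arg_cong[OF transposed_leibniz[of w x y c], of "\<lambda>a. B a d"]
    by (simp add: B_add B_scale shift)
  have "B (mult w (bracket x y z) - bracket x y (mult w z)) u = 0" for u
  proof -
    \<comment> \<open>The values of the 4-form at \<open>x\<close>, \<open>y\<close>,
      \<open>z\<close>, \<open>u\<close> with \<open>w\<close> acting on the first, second, third
      and fourth slot.\<close>
    define p q r s where "p = B (bracket (mult w x) y z) u"
      and "q = B (bracket x (mult w y) z) u"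
      and "r = B (bracket x y (mult w z)) u"
      and "s = B (bracket x y z) (mult w u)"
    have "3 * s = p + q + r"
      using slot[of z u] by (simp add: p_def q_def r_def s_def)
    moreover have "3 * r = p + q + s"
    proof -
      \<comment> \<open>Exchanging \<open>z\<close> and \<open>u\<close> in \<open>slot\<close>
        interchanges \<open>r\<close> and \<open>s\<close> and changes every sign.\<close>
      have "3 * - r = - p + - q + - s"
        using slot[of u z] skew[of x y "mult w z" u] skew[of "mult w x" y z u]
          skew[of x "mult w y" z u] skew[of x y z "mult w u"]
        by (simp add: p_def q_def r_def s_def)
      then show ?thesis
        by (simp add: algebra_simps)
    qed
    ultimately have "4 * (s - r) = 0"
      by algebra
    then show ?thesis
      using four by (simp add: B_diff shift r_def s_def)
  qed
  then show ?thesis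
    using nondeg unfolding nondegenerate_form_def by (metis right_minus_eq)
qed

text \<open>The hypothesis \<open>right\<close> puts every multiplication operator in the centroid
  of the bracket. Symmetry under one transposition and skewness under an overlapping one are
  incompatible unless the value is zero.\<close>

lemma bracket_mult_eq_0_of_centroid:
  assumes two: "(2::'f) \<noteq> 0"
    and right: "\<And>w x y z. mult w (bracket x y z) = bracket x y (mult w z)"
  shows "mult w (bracket x y z) = 0" and "bracket (mult w x) y z = 0"
proof -
  \<comment> \<open>Both sides equal \<open>bracket b c (mult a d)\<close>.\<close>
  have swap: "mult a (bracket b c d) = mult d (bracket b c a)" for a b c d
    using right mult_commute by metis
  have mult_neg: "mult a (- v) = - mult a v" for a v
  proof -
    interpret Vector_Spaces.linear scale scale "mult a"
      using mult_bilinear unfolding bilinear_map_def by blast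
    show ?thesis
      by (rule neg)
  qed
  have skew23: "mult a (bracket b c d) = - mult a (bracket b d c)" for a b c d
    using bracket_skew23[of b c d] mult_neg by simp
  have zero: "mult a (bracket b c d) = 0" for a b c d
  proof -
    \<comment> \<open>With \<open>b\<close> fixed, \<open>swap\<close> followed by
      \<open>skew23\<close> permutes \<open>a\<close>, \<open>c\<close>, \<open>d\<close> cyclically
      at the cost of a sign. Three rounds restore the order and leave the sign -1.\<close>
    have "mult a (bracket b c d) = mult d (bracket b c a)"
      by (rule swap)
    also have "\<dots> = - mult d (bracket b a c)"
      by (rule skew23)
    also have "\<dots> = - mult c (bracket b a d)"
      by (simp only: swap[of d b a c])
    also have "\<dots> = mult c (bracket b d a)"
      using skew23[of c b a d] by simp
    also have "\<dots> = mult a (bracket b d c)"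
      by (rule swap)
    also have "\<dots> = - mult a (bracket b c d)"
      by (rule skew23)
    finally show ?thesis
      using eq_neg_self_imp_zero[OF two] by blast
  qed
  show "mult w (bracket x y z) = 0"
    by (rule zero)
  \<comment> \<open>A cyclic rotation is even, and it brings the product to the slot where
    \<open>right\<close> applies.\<close>
  have "bracket (mult w x) y z = bracket y z (mult w x)"
    using bracket_skew12[of "mult w x" y z] bracket_skew23[of y "mult w x" z] by simp
  then show "bracket (mult w x) y z = 0"
    using zero right by metis
qed

end

theorem proposition5p7:
  fixes scale :: "'f::field_char_0 \<Rightarrow> 'b::ab_group_add \<Rightarrow> 'b"
    and mult :: "'b \<Rightarrow> 'b \<Rightarrow> 'b"
    and bracket :: "'b \<Rightarrow> 'b \<Rightarrow> 'b \<Rightarrow> 'b"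
    and B :: "'b \<Rightarrow> 'b \<Rightarrow> 'f"
  assumes "transposed_poisson_three_lie_algebra scale mult bracket"
    and "\<exists>basis. finite_dimensional_vector_space scale basis"
    and "bilinear_map scale (*) B"
    and "symmetric_form B"
    and "nondegenerate_form B"
    and "mult_invariant_form mult B"
    and "bracket_invariant_form bracket B"
  shows "\<forall>x y z w. mult w (bracket x y z) = bracket (mult w x) y z
                 \<and> bracket (mult w x) y z = 0"
proof -
  interpret transposed_poisson_three_lie_algebra scale mult bracket
    by (rule assms(1))
  have right: "mult w (bracket x y z) = bracket x y (mult w z)" for w x y z
    using mult_bracket_right_of_invariant_form[OF _ assms(3,5,6,7)] by simp
  show ?thesis
    using bracket_mult_eq_0_of_centroid[OF _ right] by simp
qed

end
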